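(* Let $\mathcal G$ be a maximal compact subgroup of $O(m)$. Let $A=A_1+iA_2\in M(n,\mathbb C)$ with $A_1,A_2$ real, $A_1A_1^*\in\mathcal S_{>0}(n,\mathbb R)$, and such that: (a) $A_2A_1^*-A_1A_2^*\neq0$ if $-I\notin\mathcal G$; (b) $A_2=0$ if $-I\in\mathcal G$. Suppose either $m=2$, or $m\in\mathbb N$ and $-I\in\mathcal G$. Then there is a scalar (nonnegative) measure $\Lambda$ on $\mathcal B(S^{m-1})$ such that the measure $$\Xi(d\theta)=AA^*\Lambda(d\theta)+\overline{AA^*}\,\Lambda(-d\theta)$$ is Hermitian ($\Xi(-d\theta)=\overline{\Xi(d\theta)}$) and $\mathcal S_{\ge0}(n,\mathbb C)$-valued, its support is a finite union $\bigcup_{j=1}^{k_\Xi}C_j$ of pairwise disjoint connected components $C_j$, and $\mathcal S^{\mathrm{dom}}(\Xi)=\mathcal G$.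
   Context: $O(m)$ orthogonal group; $S^{m-1}$ Euclidean unit sphere; $M(n,\mathbb C)$ complex $n\times n$ matrices; $A^*$ conjugate transpose; $\overline A$ entrywise conjugate; $\mathcal S_{>0}(n,\mathbb R)$ real symmetric positive definite matrices; $\mathcal S_{\ge0}(n,\mathbb C)$ Hermitian positive semidefinite matrices. Orbit equivalence: subgroups $\mathcal G\sim\mathcal K$ of $GL(m,\mathbb R)$ iff $\{Gx:G\in\mathcal G\}=\{Kx:K\in\mathcal K\}$ for all $x\in\mathbb R^m$; a group is maximal if it contains every group in its equivalence class. For a (matrix-valued) measure $\mu$ on $\mathcal B(S^{m-1})$, $\mathcal S^{\mathrm{dom}}(\mu)=\{C\in M(m,\mathbb R):\mu(C^{-1}B)=\mu(B)\ \text{for all Borel }B\}$. *)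

theory Defs
  imports "HOL-Analysis.Analysis"
begin

section \<open>Real matrix groups\<close>

text \<open>Subgroup of GL(m,R).\<close>
definition matgroup :: "(real^'m^'m) set \<Rightarrow> bool" where
  "matgroup G \<longleftrightarrow> mat 1 \<in> G \<and> (\<forall>A\<in>G. \<forall>B\<in>G. A ** B \<in> G)
     \<and> (\<forall>A\<in>G. invertible A \<and> matrix_inv A \<in> G)"

text \<open>The orthogonal group O(m).\<close>
definition orth_group :: "(real^'m^'m) set" where
  "orth_group = {A. orthogonal_matrix A}"

text \<open>Orbit equivalence of subgroups of GL(m,R).\<close>
definition orbit_equiv :: "(real^'m^'m) set \<Rightarrow> (real^'m^'m) set \<Rightarrow> bool" where
  "orbit_equiv G K \<longleftrightarrow> (\<forall>x. {g *v x | g. g \<in> G} = {k *v x | k. k \<in> K})"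

text \<open>Maximal: contains every group in its orbit-equivalence class.\<close>
definition maximal_group :: "(real^'m^'m) set \<Rightarrow> bool" where
  "maximal_group G \<longleftrightarrow> matgroup G \<and> (\<forall>K. matgroup K \<and> orbit_equiv G K \<longrightarrow> K \<subseteq> G)"

text \<open>Maximal compact subgroup of O(m).\<close>
definition maximal_compact_subgroup_O :: "(real^'m^'m) set \<Rightarrow> bool" where
  "maximal_compact_subgroup_O G \<longleftrightarrow>
     matgroup G \<and> G \<subseteq> orth_group \<and> compact G \<and> maximal_group G"

section \<open>Matrices\<close>

definition cadj :: "complex^'n^'n \<Rightarrow> complex^'n^'n" where
  "cadj A = (\<chi> i j. cnj (A $ j $ i))"

definition cconj :: "complex^'n^'n \<Rightarrow> complex^'n^'n" where
  "cconj A = (\<chi> i j. cnj (A $ i $ j))"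

definition re_part :: "complex^'n^'n \<Rightarrow> real^'n^'n" where
  "re_part A = (\<chi> i j. Re (A $ i $ j))"

definition im_part :: "complex^'n^'n \<Rightarrow> real^'n^'n" where
  "im_part A = (\<chi> i j. Im (A $ i $ j))"

text \<open>Real symmetric positive definite matrices.\<close>
definition sym_pos_def :: "real^'n^'n \<Rightarrow> bool" where
  "sym_pos_def M \<longleftrightarrow> transpose M = M \<and> (\<forall>x. x \<noteq> 0 \<longrightarrow> x \<bullet> (M *v x) > 0)"

text \<open>Hermitian positive semidefinite complex matrices.\<close>
definition herm_psd :: "complex^'n^'n \<Rightarrow> bool" where
  "herm_psd M \<longleftrightarrow> cadj M = M \<and>
     (\<forall>x::complex^'n. (\<Sum>i\<in>UNIV. \<Sum>j\<in>UNIV. cnj (x $ i) * M $ i $ j * x $ j) \<in> \<real> \<and>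
        Re (\<Sum>i\<in>UNIV. \<Sum>j\<in>UNIV. cnj (x $ i) * M $ i $ j * x $ j) \<ge> 0)"

section \<open>Measures on the sphere\<close>

abbreviation S_sphere :: "(real^'m) set" where
  "S_sphere \<equiv> sphere 0 1"

text \<open>Borel sigma-algebra of the unit sphere S^{m-1}.\<close>
abbreviation sphere_borel :: "(real^'m) set set" where
  "sphere_borel \<equiv> sets (restrict_space borel (sphere (0::real^'m) 1))"

text \<open>The matrix-valued measure Xi(B) = A A^* Lambda(B) + conj(A A^*) Lambda(-B).\<close>
definition Xi_measure :: "complex^'n^'n \<Rightarrow> (real^'m) measure \<Rightarrow> (real^'m) set \<Rightarrow> complex^'n^'n" where
  "Xi_measure A \<Lambda> B =
     of_real (measure \<Lambda> B) *\<^sub>R (A ** cadj A)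
     + of_real (measure \<Lambda> (uminus ` B)) *\<^sub>R cconj (A ** cadj A)"

text \<open>Support of a matrix-valued measure on the sphere.\<close>
definition mat_supp :: "((real^'m) set \<Rightarrow> 'a::zero) \<Rightarrow> (real^'m) set" where
  "mat_supp \<mu> = {\<theta> \<in> sphere 0 1. \<forall>U. open U \<and> \<theta> \<in> U \<longrightarrow> \<mu> (U \<inter> sphere 0 1) \<noteq> 0}"

text \<open>S^dom(mu) = {C in M(m,R). mu(C^{-1}B) = mu(B) for all Borel B}, where
  C^{-1}B is the preimage of B in the sphere.\<close>
definition S_dom :: "((real^'m) set \<Rightarrow> 'a) \<Rightarrow> (real^'m^'m) set" where
  "S_dom \<mu> = {C. \<forall>B \<in> sphere_borel. \<mu> {\<theta> \<in> sphere 0 1. C *v \<theta> \<in> B} = \<mu> B}"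

end

theory Submission
  imports Defs
begin

text \<open>
  Lambda is taken to be surface measure on the sphere weighted by a G-invariant density whose
  base-4 digits tell, for each set V k of a countable basis, whether a point lies in the
  G-saturation of V k. A matrix C preserving Lambda is orthogonal (Lambda has full support)
  and its transpose preserves the density almost everywhere, hence maps each saturation into
  its closure; as orbits of the compact group G are closed, the transpose moves every point
  within its G-orbit, and maximality of G puts it, and so C, in G.
  Since Xi(B) = Lambda(B) A A* + Lambda(-B) conj(A A*), the real diagonal of Xi recovers
  Lambda(B) + Lambda(-B), and the imaginary part of A A*, nonzero when -I is not in G,
  recovers Lambda(B) - Lambda(-B); when -I is in G, Lambda is already symmetric. Hence the
  matrices preserving Xi are those preserving Lambda, namely G.
\<close>

declare transpose_matrix_vector [simp del]

section \<open>Orthogonal invariance of Lebesgue measure\<close>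

text \<open>The library proves invariance of Lebesgue measure under orthogonal maps only for index
  types of class wellorder; a copy of the finite index type carries such an order, and the
  result transfers back along the coordinate isomorphism.\<close>

typedef 'a wellorder_copy = "UNIV :: 'a set" by simp

instance wellorder_copy :: (finite) finite
proof
  have "(UNIV :: 'a wellorder_copy set) = Abs_wellorder_copy ` UNIV"
    by (metis Abs_wellorder_copy_cases surj_def)
  then show "finite (UNIV :: 'a wellorder_copy set)"
    by (metis finite finite_imageI)
qed

instantiation wellorder_copy :: (finite) wellorder
begin

definition less_eq_wellorder_copy :: "'a wellorder_copy \<Rightarrow> 'a wellorder_copy \<Rightarrow> bool" where
  "x \<le> y \<longleftrightarrow> to_nat (Rep_wellorder_copy x) \<le> to_nat (Rep_wellorder_copy y)"

definition less_wellorder_copy :: "'a wellorder_copy \<Rightarrow> 'a wellorder_copy \<Rightarrow> bool" where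
  "x < y \<longleftrightarrow> to_nat (Rep_wellorder_copy x) < to_nat (Rep_wellorder_copy y)"

instance
proof
  fix x y z :: "'a wellorder_copy"
  show "x < y \<longleftrightarrow> x \<le> y \<and> \<not> y \<le> x" "x \<le> x" "x \<le> y \<or> y \<le> x"
    by (auto simp: less_eq_wellorder_copy_def less_wellorder_copy_def)
  show "x \<le> y \<Longrightarrow> y \<le> z \<Longrightarrow> x \<le> z"
    by (simp add: less_eq_wellorder_copy_def)
  show "x \<le> y \<Longrightarrow> y \<le> x \<Longrightarrow> x = y"
    by (simp add: less_eq_wellorder_copy_def Rep_wellorder_copy_inject)
next
  fix P :: "'a wellorder_copy \<Rightarrow> bool" and a
  assume step: "\<And>x. (\<And>y. y < x \<Longrightarrow> P y) \<Longrightarrow> P x"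
  show "P a"
    by (induction "to_nat (Rep_wellorder_copy a)" arbitrary: a rule: less_induct)
       (rule step, auto simp: less_wellorder_copy_def)
qed

end

definition to_copy :: "real^'n \<Rightarrow> real^'n wellorder_copy" where
  "to_copy x = (\<chi> i. x $ Rep_wellorder_copy i)"

definition of_copy :: "real^'n wellorder_copy \<Rightarrow> real^'n" where
  "of_copy y = (\<chi> j. y $ Abs_wellorder_copy j)"

lemma of_to_copy [simp]: "of_copy (to_copy x) = x"
  and to_of_copy [simp]: "to_copy (of_copy y) = y"
  by (auto simp: to_copy_def of_copy_def vec_eq_iff Abs_wellorder_copy_inverse Rep_wellorder_copy_inverse)

lemma linear_to_copy: "linear to_copy" and linear_of_copy: "linear of_copy"
  by (auto simp: to_copy_def of_copy_def linear_iff vec_eq_iff)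

lemma sum_Rep_wellorder_copy: "(\<Sum>i\<in>UNIV. f (Rep_wellorder_copy i)) = sum f UNIV"
  by (rule sum.reindex_bij_witness[of _ Abs_wellorder_copy Rep_wellorder_copy])
     (auto simp: Abs_wellorder_copy_inverse Rep_wellorder_copy_inverse)

lemma prod_Rep_wellorder_copy: "(\<Prod>i\<in>UNIV. f (Rep_wellorder_copy i)) = prod f UNIV"
  by (rule prod.reindex_bij_witness[of _ Abs_wellorder_copy Rep_wellorder_copy])
     (auto simp: Abs_wellorder_copy_inverse Rep_wellorder_copy_inverse)

lemma norm_to_copy [simp]: "norm (to_copy x) = norm x"
  using sum_Rep_wellorder_copy[of "\<lambda>j. (x $ j)\<^sup>2"]
  by (simp add: norm_vec_def L2_set_def to_copy_def)

lemma norm_of_copy [simp]: "norm (of_copy y) = norm y"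
  by (metis norm_to_copy to_of_copy)

lemma prod_Basis_vec: "(\<Prod>b\<in>(Basis::(real^'n) set). f b) = (\<Prod>i\<in>UNIV. f (axis i 1))"
proof -
  have "(Basis::(real^'n) set) = range (\<lambda>i. axis i 1)"
    by (auto simp: Basis_vec_def)
  then show ?thesis
    by (metis (no_types, lifting) axis_eq_axis inj_on_def prod.reindex_cong zero_neq_one)
qed

lemma borel_measurable_of_copy [measurable]: "of_copy \<in> borel_measurable borel"
  by (intro borel_measurable_continuous_onI linear_continuous_on) (simp add: linear_of_copy linear_linear)

lemma distr_lborel_of_copy: "distr lborel borel of_copy = (lborel :: (real^'n) measure)"
proof (rule lborel_eqI[symmetric])
  fix l u :: "real^'n"
  assume le_Basis: "\<And>b. b \<in> Basis \<Longrightarrow> l \<bullet> b \<le> u \<bullet> b"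
  have le: "l $ i \<le> u $ i" for i
    using le_Basis[of "axis i 1"] by (simp add: inner_axis)
  have "of_copy -` box l u = box (to_copy l) (to_copy u)"
  proof (auto simp: mem_box_cart of_copy_def to_copy_def Abs_wellorder_copy_inverse)
    fix x :: "real^'n wellorder_copy" and i
    assume "\<forall>i. l $ Rep_wellorder_copy i < x $ i \<and> x $ i < u $ Rep_wellorder_copy i"
    then show "l $ i < x $ Abs_wellorder_copy i" "x $ Abs_wellorder_copy i < u $ i"
      by (metis Abs_wellorder_copy_inverse UNIV_I)+
  next
    fix x :: "real^'n wellorder_copy" and i
    assume "\<forall>i. l $ i < x $ Abs_wellorder_copy i \<and> x $ Abs_wellorder_copy i < u $ i"
    then show "l $ Rep_wellorder_copy i < x $ i" "x $ i < u $ Rep_wellorder_copy i"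
      by (metis Rep_wellorder_copy_inverse)+
  qed
  then have "emeasure (distr lborel borel of_copy) (box l u) = emeasure lborel (box (to_copy l) (to_copy u))"
    by (simp add: emeasure_distr)
  also have "\<dots> = (\<Prod>b\<in>Basis. (to_copy u - to_copy l) \<bullet> b)"
    using le by (intro emeasure_lborel_box) (auto simp: to_copy_def Basis_vec_def inner_axis)
  also have "\<dots> = (\<Prod>b\<in>Basis. (u - l) \<bullet> b)"
    using prod_Rep_wellorder_copy[of "\<lambda>j. u $ j - l $ j"]
    by (simp add: prod_Basis_vec inner_axis to_copy_def)
  finally show "emeasure (distr lborel borel of_copy) (box l u) = (\<Prod>b\<in>Basis. (u - l) \<bullet> b)" .
qed simp

lemma emeasure_lborel_eq_measure_lebesgue:
  fixes X :: "'a::euclidean_space set"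
  assumes "X \<in> sets borel" "bounded X"
  shows "emeasure lborel X = measure lebesgue X"
proof -
  obtain r where "X \<subseteq> ball 0 r"
    using assms(2) bounded_subset_ballD by blast
  then have "emeasure lborel X \<le> emeasure lborel (ball (0::'a) r)"
    by (intro emeasure_mono) auto
  then have "emeasure lborel X \<noteq> \<infinity>"
    using emeasure_lborel_ball_finite[of "0::'a" r] by (auto simp: top_unique)
  then show ?thesis
    using assms(1) by (simp add: emeasure_eq_ennreal_measure)
qed

lemma vimage_of_copy: "of_copy -` S = to_copy ` S"
proof
  show "of_copy -` S \<subseteq> to_copy ` S"
    by (auto intro!: image_eqI[where f = to_copy and x = "of_copy _"])
qed auto

lemma emeasure_lborel_image_to_copy:
  "X \<in> sets borel \<Longrightarrow> emeasure lborel (to_copy ` X) = emeasure lborel X"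
  by (subst (2) distr_lborel_of_copy[symmetric]) (simp add: emeasure_distr vimage_of_copy)

lemma borel_orthogonal_transformation_image:
  fixes f :: "'a::euclidean_space \<Rightarrow> 'a"
  assumes f: "orthogonal_transformation f" and S: "S \<in> sets borel"
  shows "f ` S \<in> sets borel"
proof -
  have "bij f"
    by (rule orthogonal_transformation_bij[OF f])
  then have "f ` S = inv f -` S"
    using bij_vimage_eq_inv_image[OF bij_imp_bij_inv, of f S] by (simp add: inv_inv_eq)
  moreover have "inv f \<in> borel_measurable borel"
    using orthogonal_transformation_inv[OF f]
    by (intro borel_measurable_continuous_onI linear_continuous_on)
       (simp add: orthogonal_transformation_linear linear_linear)
  ultimately show ?thesis
    using measurable_sets_borel[OF _ S] by simp
qed

lemma emeasure_lborel_orthogonal_image: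
  fixes f :: "real^'n \<Rightarrow> real^'n"
  assumes f: "orthogonal_transformation f" and S: "S \<in> sets borel" "bounded S"
  shows "emeasure lborel (f ` S) = emeasure lborel S"
proof -
  define f' where "f' = to_copy \<circ> f \<circ> of_copy"
  have f': "orthogonal_transformation f'"
    using f unfolding orthogonal_transformation f'_def
    by (auto intro: linear_compose linear_to_copy linear_of_copy)
  let ?Y = "to_copy ` S"
  have Y: "?Y \<in> sets borel" "bounded ?Y"
    using measurable_sets_borel[OF borel_measurable_of_copy S(1)] S(2)
    by (simp_all add: vimage_of_copy bounded_linear_image linear_linear linear_to_copy)
  have img: "to_copy ` f ` S = f' ` ?Y"
    by (simp add: f'_def image_image)
  have "emeasure lborel (f ` S) = emeasure lborel (f' ` ?Y)"
    using borel_orthogonal_transformation_image[OF f S(1)]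
    by (simp add: emeasure_lborel_image_to_copy flip: img)
  also have "\<dots> = measure lebesgue (f' ` ?Y)"
    using borel_orthogonal_transformation_image[OF f' Y(1)] Y(2)
      bounded_linear_image[of ?Y f'] orthogonal_transformation_linear[OF f']
    by (simp add: emeasure_lborel_eq_measure_lebesgue linear_linear)
  also have "\<dots> = measure lebesgue ?Y"
    using Y bounded_set_imp_lmeasurable[of ?Y] by (simp add: measure_orthogonal_image[OF f'])
  also have "\<dots> = emeasure lborel S"
    using Y emeasure_lborel_image_to_copy[OF S(1)] by (simp add: emeasure_lborel_eq_measure_lebesgue)
  finally show ?thesis .
qed

lemma orthogonal_matrix_vimage_eq_image:
  assumes "orthogonal_matrix g"
  shows "(*v) g -` E = (*v) (transpose g) ` E"
proof (intro set_eqI iffI)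
  fix x assume "x \<in> (*v) g -` E"
  moreover have "x = transpose g *v (g *v x)"
    using assms by (simp add: orthogonal_matrix_def matrix_vector_mul_assoc)
  ultimately show "x \<in> (*v) (transpose g) ` E"
    by blast
next
  fix x assume "x \<in> (*v) (transpose g) ` E"
  then show "x \<in> (*v) g -` E"
    using assms by (auto simp: orthogonal_matrix_def matrix_vector_mul_assoc)
qed

lemma emeasure_lborel_orthogonal_vimage:
  fixes g :: "real^'n^'n"
  assumes "orthogonal_matrix g" "E \<in> sets borel" "bounded E"
  shows "emeasure lborel ((*v) g -` E) = emeasure lborel E"
  unfolding orthogonal_matrix_vimage_eq_image[OF assms(1)]
  using assms by (intro emeasure_lborel_orthogonal_image) (simp_all add: orthogonal_transformation_matrix)

lemma orthogonal_matrix_inverse_vector: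
  assumes "orthogonal_matrix g"
  shows "transpose g *v (g *v x) = x" "g *v (transpose g *v x) = x"
  using assms by (auto simp: orthogonal_matrix_def matrix_vector_mul_assoc)

lemma norm_orthogonal_matrix_vector:
  fixes g :: "real^'n^'n"
  assumes "orthogonal_matrix g"
  shows "norm (g *v x) = norm x"
  using assms orthogonal_transformation_matrix[of "(*v) g"]
  by (simp add: orthogonal_transformation)

lemma mem_sphere_borel_iff: "B \<in> sphere_borel \<longleftrightarrow> B \<in> sets borel \<and> B \<subseteq> sphere 0 1"
  by (auto simp: sets_restrict_space_iff)

lemma borel_measurable_matrix_vector_mult [measurable]:
  "((*v) (g :: real^'n^'m)) \<in> borel_measurable borel"
  by (intro borel_measurable_continuous_onI linear_continuous_on matrix_vector_mul_bounded_linear)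

lemma sphere_vimage_in_sphere_borel:
  fixes g :: "real^'n^'n"
  assumes "B \<in> sphere_borel"
  shows "{\<theta> \<in> sphere 0 1. g *v \<theta> \<in> B} \<in> sphere_borel"
proof -
  have "(*v) g -` B \<in> sets borel"
    using assms measurable_sets_borel[OF borel_measurable_matrix_vector_mult]
    by (auto simp: mem_sphere_borel_iff)
  moreover have "{\<theta> \<in> sphere 0 1. g *v \<theta> \<in> B} = sphere 0 1 \<inter> (*v) g -` B"
    by auto
  ultimately show ?thesis
    by (simp add: mem_sphere_borel_iff)
qed

section \<open>The cone measure on the sphere\<close>

text \<open>The measure of B is the Lebesgue measure of the truncated cone over B, a constant
  multiple of surface measure.\<close>

definition cone_measure :: "(real^'n) measure" where
  "cone_measure = distr (restrict_space lborel (ball 0 1 - {0})) (restrict_space borel (sphere 0 1)) sgn"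

lemma sets_cone_measure [simp]: "sets cone_measure = sphere_borel"
  and space_cone_measure [simp]: "space cone_measure = sphere 0 1"
  by (simp_all add: cone_measure_def space_restrict_space)

lemma measurable_sgn_punctured_ball:
  "sgn \<in> measurable (restrict_space lborel (ball 0 1 - {0})) (restrict_space borel (sphere 0 1))"
proof (rule measurable_restrict_space2)
  show "sgn \<in> space (restrict_space lborel (ball 0 1 - {0})) \<rightarrow> sphere 0 1"
    by (auto simp: space_restrict_space norm_sgn)
  show "sgn \<in> borel_measurable (restrict_space lborel (ball 0 1 - {0}))"
    by (rule measurable_restrict_space1) simp
qed

lemma cone_in_borel:
  assumes "B \<in> sphere_borel"
  shows "sgn -` B \<inter> (ball 0 1 - {0}) \<in> sets borel"
  using assms measurable_sets_borel[OF borel_measurable_sgn]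
  by (intro sets.Int sets.Diff) (auto simp: mem_sphere_borel_iff)

lemma emeasure_cone_measure:
  assumes "B \<in> sphere_borel"
  shows "emeasure cone_measure B = emeasure lborel (sgn -` B \<inter> (ball 0 1 - {0}))"
  using assms unfolding cone_measure_def
  by (simp add: emeasure_distr[OF measurable_sgn_punctured_ball] emeasure_restrict_space
      space_restrict_space)

lemma finite_measure_cone_measure: "finite_measure (cone_measure :: (real^'n) measure)"
proof
  have "sphere 0 1 \<in> (sphere_borel :: (real^'n) set set)"
    by (simp add: mem_sphere_borel_iff)
  from emeasure_cone_measure[OF this]
  have "emeasure (cone_measure :: (real^'n) measure) (space cone_measure)
      = emeasure lborel (sgn -` sphere 0 1 \<inter> (ball (0::real^'n) 1 - {0}))"
    by simp
  also have "\<dots> \<le> emeasure lborel (ball (0::real^'n) 1)"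
    by (rule emeasure_mono) auto
  finally
  show "emeasure (cone_measure :: (real^'n) measure) (space cone_measure) \<noteq> \<infinity>"
    using emeasure_lborel_ball_finite[of "0::real^'n" 1] by (auto simp: top_unique)
qed

lemma emeasure_cone_measure_pos:
  assumes W: "open W" and p: "p \<in> W \<inter> sphere 0 1"
  shows "emeasure cone_measure (W \<inter> sphere (0::real^'n) 1) > 0"
proof -
  let ?O = "(ball 0 1 - {0}) \<inter> sgn -` W"
  have "continuous_on (ball 0 1 - {0}) (sgn :: real^'n \<Rightarrow> real^'n)"
    by (intro continuous_at_imp_continuous_on ballI isCont_sgn) auto
  then have "open ?O"
    using W by (intro continuous_open_preimage) auto
  moreover have "(1/2) *\<^sub>R p \<in> ?O"
    using p by (auto simp: sgn_scaleR sgn_div_norm)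
  ultimately obtain r where r: "r > 0" "ball ((1/2) *\<^sub>R p) r \<subseteq> ?O"
    using open_contains_ball by blast
  have WS: "W \<inter> sphere 0 1 \<in> sphere_borel"
    using W by (simp add: mem_sphere_borel_iff)
  have "0 < emeasure lborel (ball ((1/2) *\<^sub>R p) r)"
    using r(1) by (simp add: emeasure_ball)
  also have "\<dots> \<le> emeasure lborel (sgn -` (W \<inter> sphere 0 1) \<inter> (ball 0 1 - {0}))"
    using r(2) cone_in_borel[OF WS] by (intro emeasure_mono) (fastforce simp: norm_sgn)+
  also have "\<dots> = emeasure cone_measure (W \<inter> sphere 0 1)"
    by (rule emeasure_cone_measure[OF WS, symmetric])
  finally show ?thesis .
qed

lemma emeasure_cone_measure_orthogonal_vimage:
  assumes g: "orthogonal_matrix g" and B: "B \<in> sphere_borel"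
  shows "emeasure cone_measure {\<theta> \<in> sphere 0 1. g *v \<theta> \<in> B} = emeasure cone_measure B"
proof -
  let ?E = "sgn -` B \<inter> (ball 0 1 - {0})"
  have cone_eq: "sgn -` {\<theta> \<in> sphere 0 1. g *v \<theta> \<in> B} \<inter> (ball 0 1 - {0}) = (*v) g -` ?E"
  proof -
    have "g *v x = 0 \<longleftrightarrow> x = 0" for x
      by (metis norm_eq_zero norm_orthogonal_matrix_vector[OF g])
    moreover have "sgn (g *v x) = g *v sgn x" for x
      by (simp add: sgn_div_norm matrix_vector_mult_scaleR norm_orthogonal_matrix_vector[OF g])
    ultimately show ?thesis
      by (auto simp: norm_orthogonal_matrix_vector[OF g] norm_sgn)
  qed
  have "bounded ?E"
    by (rule bounded_subset[of "ball 0 1"]) auto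
  have "emeasure cone_measure {\<theta> \<in> sphere 0 1. g *v \<theta> \<in> B}
      = emeasure lborel (sgn -` {\<theta> \<in> sphere 0 1. g *v \<theta> \<in> B} \<inter> (ball 0 1 - {0}))"
    by (rule emeasure_cone_measure[OF sphere_vimage_in_sphere_borel[OF B]])
  also have "\<dots> = emeasure lborel ?E"
    unfolding cone_eq by (rule emeasure_lborel_orthogonal_vimage[OF g cone_in_borel[OF B] \<open>bounded ?E\<close>])
  also have "\<dots> = emeasure cone_measure B"
    by (rule emeasure_cone_measure[OF B, symmetric])
  finally show ?thesis .
qed

lemma measurable_orthogonal_cone_measure:
  assumes "orthogonal_matrix g"
  shows "(*v) g \<in> measurable cone_measure cone_measure"
proof -
  have "(*v) g \<in> measurable (restrict_space borel (sphere 0 1)) (restrict_space borel (sphere 0 1))"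
    using assms by (intro measurable_restrict_space3) (auto simp: norm_orthogonal_matrix_vector)
  then show ?thesis
    by (simp add: measurable_cong_sets[OF sets_cone_measure sets_cone_measure])
qed

lemma distr_cone_measure_orthogonal:
  assumes g: "orthogonal_matrix g"
  shows "distr cone_measure cone_measure ((*v) g) = cone_measure"
proof (rule measure_eqI)
  fix B assume "B \<in> sets (distr cone_measure cone_measure ((*v) g))"
  then have B: "B \<in> sphere_borel" by simp
  have "emeasure (distr cone_measure cone_measure ((*v) g)) B
      = emeasure cone_measure ((*v) g -` B \<inter> space cone_measure)"
    using B by (simp add: emeasure_distr measurable_orthogonal_cone_measure[OF g])
  also have "(*v) g -` B \<inter> space cone_measure = {\<theta> \<in> sphere 0 1. g *v \<theta> \<in> B}"
    by auto
  finally show "emeasure (distr cone_measure cone_measure ((*v) g)) B = emeasure cone_measure B"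
    using emeasure_cone_measure_orthogonal_vimage[OF g B] by simp
qed simp

lemma nn_integral_cone_measure_orthogonal:
  assumes g: "orthogonal_matrix g" and h: "h \<in> borel_measurable cone_measure"
  shows "(\<integral>\<^sup>+ \<theta>. h (g *v \<theta>) \<partial>cone_measure) = (\<integral>\<^sup>+ \<theta>. h \<theta> \<partial>cone_measure)"
  using nn_integral_distr[OF measurable_orthogonal_cone_measure[OF g], of h] h
  by (simp add: distr_cone_measure_orthogonal[OF g])

lemma borel_measurable_cone_measure:
  "f \<in> borel_measurable borel \<Longrightarrow> f \<in> borel_measurable (cone_measure :: (real^'n) measure)"
  by (simp add: measurable_cong_sets[OF sets_cone_measure refl] measurable_restrict_space1)

lemma nn_integral_cone_measure_bounded:
  assumes "\<And>\<theta>. f \<theta> \<le> ennreal c"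
  shows "(\<integral>\<^sup>+ \<theta>. f \<theta> \<partial>(cone_measure :: (real^'n) measure)) < \<infinity>"
proof -
  have "(\<integral>\<^sup>+ \<theta>. f \<theta> \<partial>cone_measure) \<le> (\<integral>\<^sup>+ \<theta>. ennreal c \<partial>(cone_measure :: (real^'n) measure))"
    using assms by (intro nn_integral_mono) simp
  also have "\<dots> < \<infinity>"
    using finite_measure.emeasure_finite[OF finite_measure_cone_measure, of "space cone_measure"]
    by (auto simp: nn_integral_const ennreal_mult_less_top less_top)
  finally show ?thesis .
qed

section \<open>Subgroups of O(m) and their saturations\<close>

lemma orthogonal_matrix_inv:
  fixes g :: "real^'n^'n"
  assumes "orthogonal_matrix g"
  shows "invertible g" "matrix_inv g = transpose g"
proof -
  show inv: "invertible g"
    using assms by (auto simp: invertible_def orthogonal_matrix_def)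
  let ?M = "matrix_inv g"
  have "?M ** g = mat 1"
    unfolding matrix_inv_def by (rule someI2_ex) (use inv in \<open>auto simp: invertible_def\<close>)
  then have "?M = ?M ** (g ** transpose g)"
    using assms by (simp add: orthogonal_matrix_def)
  also have "\<dots> = transpose g"
    by (simp add: matrix_mul_assoc \<open>?M ** g = mat 1\<close>)
  finally show "matrix_inv g = transpose g" .
qed

definition orthogonal_subgroup :: "(real^'n^'n) set \<Rightarrow> bool" where
  "orthogonal_subgroup G \<longleftrightarrow> matgroup G \<and> G \<subseteq> orth_group"

lemma maximal_compact_subgroup_O_imp_orthogonal_subgroup:
  "maximal_compact_subgroup_O G \<Longrightarrow> orthogonal_subgroup G"
  by (simp add: maximal_compact_subgroup_O_def orthogonal_subgroup_def)

context
  fixes G :: "(real^'n^'n) set"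
  assumes G: "orthogonal_subgroup G"
begin

lemma orthogonal_subgroup_orthogonal: "g \<in> G \<Longrightarrow> orthogonal_matrix g"
  using G by (auto simp: orthogonal_subgroup_def orth_group_def)

lemma orthogonal_subgroup_one: "mat 1 \<in> G"
  using G by (simp add: orthogonal_subgroup_def matgroup_def)

lemma orthogonal_subgroup_mult: "g \<in> G \<Longrightarrow> h \<in> G \<Longrightarrow> g ** h \<in> G"
  using G by (simp add: orthogonal_subgroup_def matgroup_def)

lemma orthogonal_subgroup_transpose: "g \<in> G \<Longrightarrow> transpose g \<in> G"
  using G orthogonal_matrix_inv(2)[OF orthogonal_subgroup_orthogonal]
  by (auto simp: orthogonal_subgroup_def matgroup_def)

end

definition saturation :: "(real^'n^'n) set \<Rightarrow> (real^'n) set \<Rightarrow> (real^'n) set" where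
  "saturation G V = (\<Union>g\<in>G. (*v) g ` V)"

lemma open_saturation:
  assumes "orthogonal_subgroup G" "open V"
  shows "open (saturation G V)"
  unfolding saturation_def
proof (intro open_UN ballI open_surjective_linear_image[OF \<open>open V\<close>])
  fix g assume "g \<in> G"
  then have "orthogonal_transformation ((*v) g)"
    using assms(1) by (simp add: orthogonal_transformation_matrix orthogonal_subgroup_orthogonal)
  then show "linear ((*v) g)" "surj ((*v) g)"
    by (simp_all add: orthogonal_transformation_linear orthogonal_transformation_surj)
qed

lemma saturation_invariant:
  assumes G: "orthogonal_subgroup G" and h: "h \<in> G"
  shows "h *v x \<in> saturation G V \<longleftrightarrow> x \<in> saturation G V"
proof
  assume "h *v x \<in> saturation G V"
  then obtain g v where gv: "g \<in> G" "v \<in> V" "h *v x = g *v v"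
    unfolding saturation_def by blast
  have "x = transpose h *v (h *v x)"
    using orthogonal_matrix_inverse_vector(1)[OF orthogonal_subgroup_orthogonal[OF G h]] by simp
  also have "\<dots> = (transpose h ** g) *v v"
    using gv by (simp add: matrix_vector_mul_assoc)
  finally show "x \<in> saturation G V"
    unfolding saturation_def
    using gv orthogonal_subgroup_mult[OF G orthogonal_subgroup_transpose[OF G h] gv(1)] by blast
next
  assume "x \<in> saturation G V"
  then obtain g v where gv: "g \<in> G" "v \<in> V" "x = g *v v"
    unfolding saturation_def by blast
  then have "h *v x = (h ** g) *v v"
    by (simp add: matrix_vector_mul_assoc)
  then show "h *v x \<in> saturation G V"
    unfolding saturation_def using gv orthogonal_subgroup_mult[OF G h gv(1)] by blast
qed

section \<open>Orbit-separating weights\<close>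

lemma quarter_series_summable:
  assumes "\<And>k. b k \<in> {0, 1}"
  shows "summable (\<lambda>k. (1/4::real)^k * b k)"
proof (rule summable_comparison_test'[OF summable_geometric[of "1/4::real"]])
  show "norm ((1/4::real)^n * b n) \<le> (1/4)^n" for n
    using assms[of n] by auto
qed auto

lemma quarter_series_bounds:
  assumes "\<And>k. b k \<in> {0, 1}"
  shows "0 \<le> (\<Sum>k. (1/4::real)^k * b k)" "(\<Sum>k. (1/4::real)^k * b k) \<le> 4/3"
proof -
  have "0 \<le> (1/4::real)^k * b k" "(1/4::real)^k * b k \<le> (1/4)^k" for k
    using assms[of k] by auto
  then show "0 \<le> (\<Sum>k. (1/4::real)^k * b k)"
    by (intro suminf_nonneg[OF quarter_series_summable[OF assms]])
  have "(\<Sum>k. (1/4::real)^k * b k) \<le> (\<Sum>k. (1/4::real)^k)"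
    using \<open>\<And>k. (1/4::real)^k * b k \<le> (1/4)^k\<close>
    by (intro suminf_le quarter_series_summable[OF assms] summable_geometric) auto
  also have "\<dots> = 4/3"
    by (subst suminf_geometric) auto
  finally show "(\<Sum>k. (1/4::real)^k * b k) \<le> 4/3" .
qed

lemma quarter_series_split_head:
  assumes "\<And>k. b k \<in> {0, 1}"
  shows "(\<Sum>k. (1/4::real)^k * b k) = b 0 + (\<Sum>k. (1/4)^k * b (Suc k)) / 4"
proof -
  have "summable (\<lambda>k. (1/4::real)^k * b (Suc k))"
    using assms by (intro quarter_series_summable) auto
  then have "(\<Sum>k. (1/4::real)^Suc k * b (Suc k)) = (\<Sum>k. (1/4)^k * b (Suc k)) / 4"
    by (simp add: suminf_divide[symmetric])
  moreover have "(\<Sum>k. (1/4::real)^Suc k * b (Suc k)) = (\<Sum>k. (1/4)^k * b k) - b 0"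
    using suminf_split_head[OF quarter_series_summable[OF assms]] by simp
  ultimately show ?thesis
    by simp
qed

text \<open>The first digit is determined by the value, since the remaining ones contribute at
  most 1/3.\<close>

lemma quarter_series_digits_head:
  assumes b: "\<And>k. b k \<in> {0, 1}" and c: "\<And>k. c k \<in> {0, 1}"
    and eq: "(\<Sum>k. (1/4::real)^k * b k) = (\<Sum>k. (1/4)^k * c k)"
  shows "b 0 = c 0" "(\<Sum>k. (1/4::real)^k * b (Suc k)) = (\<Sum>k. (1/4)^k * c (Suc k))"
proof -
  let ?tb = "\<Sum>k. (1/4::real)^k * b (Suc k)" and ?tc = "\<Sum>k. (1/4::real)^k * c (Suc k)"
  have "b 0 + ?tb / 4 = (\<Sum>k. (1/4)^k * b k)"
    by (rule quarter_series_split_head[OF b, symmetric])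
  also have "\<dots> = c 0 + ?tc / 4"
    unfolding eq by (rule quarter_series_split_head[OF c])
  finally have split: "b 0 + ?tb / 4 = c 0 + ?tc / 4" .
  have "0 \<le> ?tb" "?tb \<le> 4/3"
    using quarter_series_bounds[of "\<lambda>k. b (Suc k)"] b by auto
  moreover have "0 \<le> ?tc" "?tc \<le> 4/3"
    using quarter_series_bounds[of "\<lambda>k. c (Suc k)"] c by auto
  ultimately have "\<bar>b 0 - c 0\<bar> < 1"
    using split by linarith
  then show "b 0 = c 0"
    using b[of 0] c[of 0] by auto
  with split show "?tb = ?tc"
    by simp
qed

lemma quarter_series_digits_unique:
  assumes "\<And>k. b k \<in> {0, 1}" "\<And>k. c k \<in> {0, 1}"
    and "(\<Sum>k. (1/4::real)^k * b k) = (\<Sum>k. (1/4)^k * c k)"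
  shows "b k = c k"
  using assms
proof (induction k arbitrary: b c)
  case 0
  then show ?case
    by (rule quarter_series_digits_head(1))
next
  case (Suc k)
  have "(b \<circ> Suc) k = (c \<circ> Suc) k"
  proof (rule Suc.IH)
    show "(b \<circ> Suc) k \<in> {0, 1}" "(c \<circ> Suc) k \<in> {0, 1}" for k
      using Suc.prems(1,2) by simp_all
    show "(\<Sum>k. (1/4::real)^k * (b \<circ> Suc) k) = (\<Sum>k. (1/4)^k * (c \<circ> Suc) k)"
      using quarter_series_digits_head(2)[OF Suc.prems] by simp
  qed
  then show ?case
    by simp
qed

definition orbit_weight :: "(nat \<Rightarrow> (real^'n) set) \<Rightarrow> (real^'n^'n) set \<Rightarrow> real^'n \<Rightarrow> real" where
  "orbit_weight V G x = 1 + (\<Sum>k. (1/4)^k * indicator (saturation G (V k)) x)"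

lemma orbit_weight_bounds: "1 \<le> orbit_weight V G x" "orbit_weight V G x \<le> 3"
  using quarter_series_bounds[of "\<lambda>k. indicator (saturation G (V k)) x"]
  by (auto simp: orbit_weight_def indicator_def)

lemma borel_measurable_orbit_weight:
  assumes "orthogonal_subgroup G" "\<And>k. open (V k)"
  shows "orbit_weight V G \<in> borel_measurable borel"
proof -
  have "(\<lambda>x. (1/4::real)^k * indicator (saturation G (V k)) x) \<in> borel_measurable borel" for k
    using open_saturation[OF assms(1) assms(2)]
    by (intro borel_measurable_times borel_measurable_const borel_measurable_indicator) auto
  then show ?thesis
    unfolding orbit_weight_def by measurable
qed

lemma orbit_weight_invariant:
  assumes "orthogonal_subgroup G" "h \<in> G"
  shows "orbit_weight V G (h *v x) = orbit_weight V G x"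
  by (simp add: orbit_weight_def indicator_def saturation_invariant[OF assms])

lemma orbit_weight_eq_imp_saturation_iff:
  assumes "orbit_weight V G x = orbit_weight V G y"
  shows "x \<in> saturation G (V k) \<longleftrightarrow> y \<in> saturation G (V k)"
proof -
  have "indicator (saturation G (V k)) x = (indicator (saturation G (V k)) y :: real)"
    using assms
    by (intro quarter_series_digits_unique[where b = "\<lambda>k. indicator (saturation G (V k)) x"
          and c = "\<lambda>k. indicator (saturation G (V k)) y"])
       (simp_all add: orbit_weight_def indicator_def)
  then show ?thesis
    by (auto simp: indicator_def split: if_splits)
qed

section \<open>Orbits and maximality\<close>

lemma ex_open_basis_sequence:
  "\<exists>V :: nat \<Rightarrow> 'a::second_countable_topology set. (\<forall>k. open (V k)) \<and>
     (\<forall>U x. open U \<longrightarrow> x \<in> U \<longrightarrow> (\<exists>k. x \<in> V k \<and> V k \<subseteq> U))"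
proof -
  obtain B :: "'a set set" where B: "countable B" "topological_basis B"
    using ex_countable_basis by blast
  have "B \<noteq> {}"
    using topological_basisE[OF B(2) open_UNIV UNIV_I[of undefined]] by blast
  then show ?thesis
    using B by (intro exI[of _ "from_nat_into B"])
      (metis from_nat_into from_nat_into_surj topological_basis_open topological_basisE)
qed

lemma closed_orbit:
  fixes G :: "(real^'n^'m) set" and x :: "real^'n"
  assumes "compact G"
  shows "closed ((\<lambda>g. g *v x) ` G)"
proof -
  have "linear (\<lambda>g :: real^'n^'m. g *v x)"
    by (rule linearI) (auto simp: vec_eq_iff matrix_vector_mult_def sum.distrib sum_distrib_left
        algebra_simps)
  then show ?thesis
    using assms by (intro compact_imp_closed compact_continuous_image linear_continuous_on)
      (simp add: linear_linear)
qed

text \<open>The orbit of x is compact, so if C x lies outside it, some basic neighbourhood of x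
  has a G-saturation whose closure misses C x.\<close>

lemma mem_orbit_if_preserves_saturations:
  fixes G :: "(real^'n^'n) set"
  assumes G: "orthogonal_subgroup G" "compact G"
    and V: "\<And>U x. open U \<Longrightarrow> x \<in> U \<Longrightarrow> \<exists>k. x \<in> V k \<and> V k \<subseteq> U"
    and C: "\<And>k. x \<in> saturation G (V k) \<Longrightarrow> C *v x \<in> closure (saturation G (V k))"
  shows "\<exists>g\<in>G. C *v x = g *v x"
proof (rule ccontr)
  assume "\<not> (\<exists>g\<in>G. C *v x = g *v x)"
  then have "C *v x \<in> - (\<lambda>g. g *v x) ` G"
    by auto
  then obtain e where e: "e > 0" "ball (C *v x) e \<subseteq> - (\<lambda>g. g *v x) ` G"
    using closed_orbit[OF G(2)] open_contains_ball by (metis open_Compl)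
  obtain k where k: "x \<in> V k" "V k \<subseteq> ball x (e/2)"
    using V[of "ball x (e/2)" x] e(1) by auto
  have "x \<in> saturation G (V k)"
    unfolding saturation_def using orthogonal_subgroup_one[OF G(1)] k(1) by force
  then obtain u where u: "u \<in> saturation G (V k)" "dist u (C *v x) < e/2"
    using C closure_approachable e(1) by (metis half_gt_zero)
  then obtain g v where gv: "g \<in> G" "v \<in> V k" "u = g *v v"
    unfolding saturation_def by blast
  have "dist (g *v v) (g *v x) = dist v x"
    using norm_orthogonal_matrix_vector[OF orthogonal_subgroup_orthogonal[OF G(1) gv(1)]]
    by (simp add: dist_norm flip: matrix_vector_mult_diff_distrib)
  also have "\<dots> < e/2"
    using gv(2) k(2) by (auto simp: dist_commute)
  finally have "g *v x \<in> ball (C *v x) e"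
    using u(2) gv(3) dist_triangle[of "C *v x" "g *v x" "g *v v"] by (simp add: dist_commute)
  then show False
    using e(2) gv(1) by blast
qed

lemma matgroup_orbitwise_members:
  assumes G: "orthogonal_subgroup G"
  shows "matgroup {C. orthogonal_matrix C \<and> (\<forall>x. \<exists>g\<in>G. C *v x = g *v x)}"
    (is "matgroup ?K")
  unfolding matgroup_def
proof (intro conjI ballI)
  show "mat 1 \<in> ?K"
    using orthogonal_subgroup_one[OF G] orthogonal_matrix_id by fastforce
next
  fix A B assume A: "A \<in> ?K" and B: "B \<in> ?K"
  have "\<exists>g\<in>G. (A ** B) *v x = g *v x" for x
  proof -
    obtain g where g: "g \<in> G" "B *v x = g *v x"
      using B by blast
    obtain h where h: "h \<in> G" "A *v (g *v x) = h *v (g *v x)"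
      using A by blast
    have "(A ** B) *v x = (h ** g) *v x"
      using g h by (simp add: matrix_vector_mul_assoc[symmetric])
    then show ?thesis
      using orthogonal_subgroup_mult[OF G h(1) g(1)] by blast
  qed
  then show "A ** B \<in> ?K"
    using A B by (auto intro: orthogonal_matrix_mul)
next
  fix A assume A: "A \<in> ?K"
  then have A_orth: "orthogonal_matrix A"
    by blast
  show "invertible A"
    by (rule orthogonal_matrix_inv(1)[OF A_orth])
  have "\<exists>g\<in>G. transpose A *v x = g *v x" for x
  proof -
    obtain g where g: "g \<in> G" "A *v (transpose A *v x) = g *v (transpose A *v x)"
      using A by blast
    then have "transpose A *v x = transpose g *v x"
      using orthogonal_matrix_inverse_vector[OF A_orth]
        orthogonal_matrix_inverse_vector(1)[OF orthogonal_subgroup_orthogonal[OF G g(1)]]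
      by metis
    then show ?thesis
      using orthogonal_subgroup_transpose[OF G g(1)] by blast
  qed
  then show "matrix_inv A \<in> ?K"
    using A_orth by (simp add: orthogonal_matrix_inv(2))
qed

lemma mem_maximal_group_if_orbitwise:
  assumes G: "maximal_compact_subgroup_O G" and C: "orthogonal_matrix C"
    and orbits: "\<And>x. \<exists>g\<in>G. C *v x = g *v x"
  shows "C \<in> G"
proof -
  let ?K = "{C. orthogonal_matrix C \<and> (\<forall>x. \<exists>g\<in>G. C *v x = g *v x)}"
  have OG: "orthogonal_subgroup G"
    using G by (rule maximal_compact_subgroup_O_imp_orthogonal_subgroup)
  have "orbit_equiv G ?K"
    unfolding orbit_equiv_def
    by (fastforce dest: orthogonal_subgroup_orthogonal[OF OG])
  then have "?K \<subseteq> G"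
    using G matgroup_orbitwise_members[OF OG]
    by (simp add: maximal_compact_subgroup_O_def maximal_group_def)
  then show ?thesis
    using C orbits by blast
qed

section \<open>The measure Lambda\<close>

definition orbit_measure :: "(nat \<Rightarrow> (real^'n) set) \<Rightarrow> (real^'n^'n) set \<Rightarrow> (real^'n) measure" where
  "orbit_measure V G = density cone_measure (\<lambda>\<theta>. ennreal (orbit_weight V G \<theta>))"

lemma sets_orbit_measure [simp]: "sets (orbit_measure V G) = sphere_borel"
  by (simp add: orbit_measure_def)

context
  fixes V :: "nat \<Rightarrow> (real^'n) set" and G :: "(real^'n^'n) set"
  assumes G: "orthogonal_subgroup G" and V: "\<And>k. open (V k)"
begin

lemma borel_measurable_orbit_weight_cone_measure:
  "(\<lambda>\<theta>. ennreal (orbit_weight V G \<theta>)) \<in> borel_measurable cone_measure"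
  using borel_measurable_orbit_weight[of G V, OF G V] by (intro borel_measurable_cone_measure) measurable

lemma emeasure_orbit_measure:
  assumes "B \<in> sphere_borel"
  shows "emeasure (orbit_measure V G) B = (\<integral>\<^sup>+ \<theta>. ennreal (orbit_weight V G \<theta>) * indicator B \<theta> \<partial>cone_measure)"
  unfolding orbit_measure_def
  using assms borel_measurable_orbit_weight_cone_measure by (simp add: emeasure_density)

lemma finite_measure_orbit_measure: "finite_measure (orbit_measure V G)"
proof
  have "space (orbit_measure V G) = sphere 0 1"
    by (simp add: orbit_measure_def)
  then have "emeasure (orbit_measure V G) (space (orbit_measure V G))
      = (\<integral>\<^sup>+ \<theta>. ennreal (orbit_weight V G \<theta>) * indicator (sphere 0 1) \<theta> \<partial>cone_measure)"
    by (simp only:) (rule emeasure_orbit_measure, simp add: mem_sphere_borel_iff)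
  also have "\<dots> < \<infinity>"
    using ennreal_leI[OF orbit_weight_bounds(2)[of V G]]
    by (intro nn_integral_cone_measure_bounded[where c = 3]) (simp add: indicator_def)
  finally show "emeasure (orbit_measure V G) (space (orbit_measure V G)) \<noteq> \<infinity>"
    by simp
qed

lemma emeasure_orbit_measure_pos:
  assumes "open W" "p \<in> W \<inter> sphere 0 1"
  shows "emeasure (orbit_measure V G) (W \<inter> sphere 0 1) > 0"
proof -
  have B: "W \<inter> sphere 0 1 \<in> sphere_borel"
    using assms by (simp add: mem_sphere_borel_iff)
  have "0 < emeasure cone_measure (W \<inter> sphere 0 1)"
    by (rule emeasure_cone_measure_pos[OF assms])
  also have "\<dots> = (\<integral>\<^sup>+ \<theta>. indicator (W \<inter> sphere 0 1) \<theta> \<partial>cone_measure)"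
    using B by simp
  also have "\<dots> \<le> emeasure (orbit_measure V G) (W \<inter> sphere 0 1)"
    unfolding emeasure_orbit_measure[OF B] using orbit_weight_bounds(1)[of V G]
    by (intro nn_integral_mono) (auto split: split_indicator)
  finally show ?thesis .
qed

lemma measure_orbit_measure_pos:
  assumes "open W" "p \<in> W \<inter> sphere 0 1"
  shows "measure (orbit_measure V G) (W \<inter> sphere 0 1) > 0"
  using emeasure_orbit_measure_pos[OF assms]
    finite_measure.emeasure_eq_measure[OF finite_measure_orbit_measure]
  by simp

lemma orbit_measure_invariant:
  assumes g: "g \<in> G" and B: "B \<in> sphere_borel"
  shows "emeasure (orbit_measure V G) {\<theta> \<in> sphere 0 1. g *v \<theta> \<in> B} = emeasure (orbit_measure V G) B"
proof -
  let ?h = "\<lambda>\<theta>. ennreal (orbit_weight V G \<theta>) * indicator B \<theta>"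
  have h: "?h \<in> borel_measurable cone_measure"
    using borel_measurable_orbit_weight_cone_measure B
    by (intro borel_measurable_times_ennreal borel_measurable_indicator) simp_all
  have "emeasure (orbit_measure V G) {\<theta> \<in> sphere 0 1. g *v \<theta> \<in> B} = (\<integral>\<^sup>+ \<theta>. ?h (g *v \<theta>) \<partial>cone_measure)"
    unfolding emeasure_orbit_measure[OF sphere_vimage_in_sphere_borel[OF B]]
    by (intro nn_integral_cong) (simp add: orbit_weight_invariant[OF G g] indicator_def)
  also have "\<dots> = emeasure (orbit_measure V G) B"
    unfolding emeasure_orbit_measure[OF B]
    by (rule nn_integral_cone_measure_orthogonal[OF orthogonal_subgroup_orthogonal[OF G g] h])
  finally show ?thesis .
qed

lemma borel_measurable_orbit_weight_matrix_cone_measure: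
  "(\<lambda>\<theta>. ennreal (orbit_weight V G (D *v \<theta>))) \<in> borel_measurable cone_measure"
proof -
  have "(\<lambda>\<theta>. orbit_weight V G (D *v \<theta>)) \<in> borel_measurable borel"
    using measurable_compose[OF borel_measurable_matrix_vector_mult
        borel_measurable_orbit_weight[of G V, OF G V]] .
  then show ?thesis
    by (intro borel_measurable_cone_measure) measurable
qed

lemma density_orbit_weight_transpose:
  assumes C: "orthogonal_matrix C"
    and inv: "\<And>B. B \<in> sphere_borel \<Longrightarrow>
      emeasure (orbit_measure V G) {\<theta> \<in> sphere 0 1. C *v \<theta> \<in> B} = emeasure (orbit_measure V G) B"
  shows "density cone_measure (\<lambda>\<theta>. ennreal (orbit_weight V G (transpose C *v \<theta>))) = orbit_measure V G"
proof (rule measure_eqI)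
  fix B assume "B \<in> sets (density cone_measure (\<lambda>\<theta>. ennreal (orbit_weight V G (transpose C *v \<theta>))))"
  then have B: "B \<in> sphere_borel"
    by simp
  let ?h = "\<lambda>\<eta>. ennreal (orbit_weight V G \<eta>) * indicator B (C *v \<eta>)"
  have "indicator B \<in> borel_measurable cone_measure"
    using B by (intro borel_measurable_indicator) simp
  then have h: "?h \<in> borel_measurable cone_measure"
    using borel_measurable_orbit_weight_cone_measure measurable_compose[OF measurable_orthogonal_cone_measure[OF C]]
    by (intro borel_measurable_times_ennreal) auto
  have "emeasure (density cone_measure (\<lambda>\<theta>. ennreal (orbit_weight V G (transpose C *v \<theta>)))) B
      = (\<integral>\<^sup>+ \<theta>. ?h (transpose C *v \<theta>) \<partial>cone_measure)"
    using B borel_measurable_orbit_weight_matrix_cone_measure[of "transpose C"]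
    by (simp add: emeasure_density orthogonal_matrix_inverse_vector[OF C])
  also have "\<dots> = (\<integral>\<^sup>+ \<theta>. ?h \<theta> \<partial>cone_measure)"
    using C h by (intro nn_integral_cone_measure_orthogonal) simp_all
  also have "\<dots> = emeasure (orbit_measure V G) {\<theta> \<in> sphere 0 1. C *v \<theta> \<in> B}"
    unfolding emeasure_orbit_measure[OF sphere_vimage_in_sphere_borel[OF B]]
    by (intro nn_integral_cong) (auto simp: indicator_def)
  finally show "emeasure (density cone_measure (\<lambda>\<theta>. ennreal (orbit_weight V G (transpose C *v \<theta>)))) B
      = emeasure (orbit_measure V G) B"
    using inv[OF B] by simp
qed simp

lemma orbit_weight_AE_invariant:
  assumes C: "orthogonal_matrix C"
    and inv: "\<And>B. B \<in> sphere_borel \<Longrightarrow>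
      emeasure (orbit_measure V G) {\<theta> \<in> sphere 0 1. C *v \<theta> \<in> B} = emeasure (orbit_measure V G) B"
  shows "AE \<theta> in cone_measure. orbit_weight V G (transpose C *v \<theta>) = orbit_weight V G \<theta>"
proof -
  have "integral\<^sup>N cone_measure (\<lambda>\<theta>. ennreal (orbit_weight V G (transpose C *v \<theta>))) \<noteq> \<infinity>"
    using ennreal_leI[OF orbit_weight_bounds(2)]
    by (intro less_imp_neq nn_integral_cone_measure_bounded[where c = 3]) simp
  then have "AE \<theta> in cone_measure. ennreal (orbit_weight V G (transpose C *v \<theta>)) = ennreal (orbit_weight V G \<theta>)"
    using density_orbit_weight_transpose[OF C inv]
      finite_density_unique[OF borel_measurable_orbit_weight_matrix_cone_measure
        borel_measurable_orbit_weight_cone_measure]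
    by (simp add: orbit_measure_def)
  then show ?thesis
    using orbit_weight_bounds(1)[of V G]
    by (elim AE_mp) (auto intro!: AE_I2 simp: ennreal_inj[OF order.trans[OF zero_le_one] order.trans[OF zero_le_one]])
qed

lemma mem_closure_saturation_if_AE_invariant:
  assumes AE: "AE \<theta> in cone_measure. orbit_weight V G (D *v \<theta>) = orbit_weight V G \<theta>"
    and x: "x \<in> saturation G (V k) \<inter> sphere 0 1"
  shows "D *v x \<in> closure (saturation G (V k))"
proof (rule ccontr)
  assume "D *v x \<notin> closure (saturation G (V k))"
  let ?W = "saturation G (V k) - (*v) D -` closure (saturation G (V k))"
  have "open ?W"
    using open_saturation[OF G V]
    by (intro open_Diff continuous_closed_vimage linear_continuous_at matrix_vector_mul_bounded_linear)
       simp_all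
  then have pos: "emeasure cone_measure (?W \<inter> sphere 0 1) > 0"
    using x \<open>D *v x \<notin> _\<close> by (intro emeasure_cone_measure_pos) auto
  obtain N where N: "{\<theta> \<in> space cone_measure. orbit_weight V G (D *v \<theta>) \<noteq> orbit_weight V G \<theta>} \<subseteq> N"
    "emeasure cone_measure N = 0" "N \<in> sets cone_measure"
    using AE by (rule AE_E)
  have "?W \<inter> sphere 0 1 \<subseteq> N"
  proof
    fix \<theta> assume \<theta>: "\<theta> \<in> ?W \<inter> sphere 0 1"
    have "orbit_weight V G (D *v \<theta>) \<noteq> orbit_weight V G \<theta>"
    proof
      assume "orbit_weight V G (D *v \<theta>) = orbit_weight V G \<theta>"
      then have "D *v \<theta> \<in> saturation G (V k)"
        using \<theta> orbit_weight_eq_imp_saturation_iff by blast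
      then show False
        using \<theta> closure_subset by blast
    qed
    then show "\<theta> \<in> N"
      using N(1) \<theta> by auto
  qed
  then show False
    using pos N(2,3) emeasure_mono[of "?W \<inter> sphere 0 1" N cone_measure] by simp
qed

end

lemma orthogonal_matrix_if_norm_sphere:
  fixes C :: "real^'n^'n"
  assumes sphere: "\<And>\<theta>. \<theta> \<in> sphere 0 1 \<Longrightarrow> norm (C *v \<theta>) = 1"
  shows "orthogonal_matrix C"
proof -
  have "norm (C *v x) = norm x" for x
  proof (cases "x = 0")
    case False
    then have "C *v x = norm x *\<^sub>R (C *v sgn x)"
      by (simp add: sgn_div_norm matrix_vector_mult_scaleR)
    then show ?thesis
      using sphere[of "sgn x"] False by (simp add: norm_sgn)
  qed simp
  then have "orthogonal_transformation ((*v) C)"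
    by (simp add: orthogonal_transformation)
  then show ?thesis
    by (simp add: orthogonal_transformation_matrix)
qed

lemma orthogonal_if_preserves_full_support_measure:
  fixes M :: "(real^'n) measure" and C :: "real^'n^'n"
  assumes M: "finite_measure M" "sets M = sphere_borel"
    and pos: "\<And>W p. open W \<Longrightarrow> p \<in> W \<inter> sphere 0 1 \<Longrightarrow> emeasure M (W \<inter> sphere 0 1) > 0"
    and C: "emeasure M {\<theta> \<in> sphere 0 1. C *v \<theta> \<in> sphere 0 1} = emeasure M (sphere 0 1)"
  shows "orthogonal_matrix C"
proof -
  interpret finite_measure M
    by (rule M(1))
  let ?S = "sphere (0::real^'n) 1"
  let ?P = "{\<theta> \<in> ?S. C *v \<theta> \<in> ?S}"
  have "?S \<in> sets M" "?P \<in> sets M"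
    using M(2) sphere_vimage_in_sphere_borel[of ?S C] by (auto simp: mem_sphere_borel_iff)
  then have null: "emeasure M (?S - ?P) = 0"
    using C by (subst emeasure_Diff) (auto simp: emeasure_eq_measure)
  have "norm (C *v \<theta>) = 1" if "\<theta> \<in> ?S" for \<theta>
  proof (rule ccontr)
    let ?O = "{x. norm (C *v x) \<noteq> 1}"
    assume "norm (C *v \<theta>) \<noteq> 1"
    moreover have "open ?O"
      by (intro open_Collect_neq continuous_intros linear_continuous_at matrix_vector_mul_bounded_linear)
    ultimately have "emeasure M (?O \<inter> ?S) > 0"
      using pos that by blast
    moreover have "?O \<inter> ?S = ?S - ?P"
      by auto
    ultimately show False
      using null by simp
  qed
  then show ?thesis
    by (rule orthogonal_matrix_if_norm_sphere)
qed

lemma orbitwise_if_orbitwise_on_sphere: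
  assumes "mat 1 \<in> G" "\<And>x. x \<in> sphere 0 1 \<Longrightarrow> \<exists>g\<in>G. D *v x = g *v x"
  shows "\<exists>g\<in>G. D *v x = g *v (x :: real^'n)"
proof (cases "x = 0")
  case False
  then obtain g where "g \<in> G" "D *v sgn x = g *v sgn x"
    using assms(2)[of "sgn x"] by (auto simp: norm_sgn)
  moreover have "x = norm x *\<^sub>R sgn x"
    using False by (simp add: sgn_div_norm)
  ultimately show ?thesis
    by (metis matrix_vector_mult_scaleR)
qed (use assms(1) in auto)

text \<open>A matrix preserving the orbit measure is orthogonal because the measure has full
  support; its transpose then preserves the weight almost everywhere, hence the closure of
  every saturation, hence every orbit.\<close>

lemma mem_group_if_preserves_orbit_measure:
  fixes G :: "(real^'n^'n) set"
  assumes G: "maximal_compact_subgroup_O G"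
    and V: "\<And>k. open (V k)" "\<And>U x. open U \<Longrightarrow> x \<in> U \<Longrightarrow> \<exists>k. x \<in> V k \<and> V k \<subseteq> U"
    and inv: "\<And>B. B \<in> sphere_borel \<Longrightarrow>
      emeasure (orbit_measure V G) {\<theta> \<in> sphere 0 1. C *v \<theta> \<in> B} = emeasure (orbit_measure V G) B"
  shows "C \<in> G"
proof -
  have OG: "orthogonal_subgroup G"
    using G by (rule maximal_compact_subgroup_O_imp_orthogonal_subgroup)
  have C: "orthogonal_matrix C"
    using finite_measure_orbit_measure[where V = V, OF OG V(1)]
      emeasure_orbit_measure_pos[where V = V, OF OG V(1)]
      inv[of "sphere 0 1"]
    by (intro orthogonal_if_preserves_full_support_measure) (auto simp: mem_sphere_borel_iff)
  let ?D = "transpose C"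
  have AE: "AE \<theta> in cone_measure. orbit_weight V G (?D *v \<theta>) = orbit_weight V G \<theta>"
    using OG V(1) C inv by (rule orbit_weight_AE_invariant)
  have sphere_orbits: "\<exists>g\<in>G. ?D *v x = g *v x" if x: "x \<in> sphere 0 1" for x
  proof (rule mem_orbit_if_preserves_saturations[where V = V])
    show "compact G"
      using G by (simp add: maximal_compact_subgroup_O_def)
    show "?D *v x \<in> closure (saturation G (V k))" if "x \<in> saturation G (V k)" for k
      using mem_closure_saturation_if_AE_invariant[OF OG V(1) AE] x that by blast
  qed (fact OG | fact V(2))+
  have "\<exists>g\<in>G. ?D *v x = g *v x" for x
    using orthogonal_subgroup_one[OF OG] sphere_orbits by (rule orbitwise_if_orbitwise_on_sphere)
  then have "?D \<in> G"
    using C by (intro mem_maximal_group_if_orbitwise[OF G]) simp_all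
  then show ?thesis
    using orthogonal_subgroup_transpose[OF OG] by force
qed

section \<open>The matrix measure Xi\<close>

lemma cconj_entry [simp]: "cconj X $ i $ j = cnj (X $ i $ j)"
  by (simp add: cconj_def)

lemma cadj_entry [simp]: "cadj X $ i $ j = cnj (X $ j $ i)"
  by (simp add: cadj_def)

lemma gram_entry: "(A ** cadj A) $ i $ j = (\<Sum>l\<in>UNIV. A $ i $ l * cnj (A $ j $ l))"
  by (simp add: matrix_matrix_mult_def)

lemma scaleR_combination_entry:
  "(a *\<^sub>R X + b *\<^sub>R Y) $ i $ j = of_real a * X $ i $ j + of_real b * (Y $ i $ j :: complex)"
  by (simp only: vector_add_component vector_scaleR_component) (simp add: scaleR_conv_of_real)

lemma Re_combination_cconj: "Re ((a *\<^sub>R M + b *\<^sub>R cconj M) $ i $ j) = (a + b) * Re (M $ i $ j)"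
  by (simp add: algebra_simps)

lemma Im_combination_cconj: "Im ((a *\<^sub>R M + b *\<^sub>R cconj M) $ i $ j) = (a - b) * Im (M $ i $ j)"
  by (simp add: algebra_simps)

lemma combination_cconj_cancel:
  assumes eq: "p *\<^sub>R M + q *\<^sub>R cconj M = p' *\<^sub>R M + q' *\<^sub>R cconj M"
  shows "Re (M $ i $ j) \<noteq> 0 \<Longrightarrow> p + q = p' + q'"
    and "Im (M $ i $ j) \<noteq> 0 \<Longrightarrow> p - q = p' - q'"
proof -
  have "(p + q) * Re (M $ i $ j) = (p' + q') * Re (M $ i $ j)"
    using arg_cong[OF eq, of "\<lambda>X. Re (X $ i $ j)"] by (simp only: Re_combination_cconj)
  then show "Re (M $ i $ j) \<noteq> 0 \<Longrightarrow> p + q = p' + q'"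
    by simp
  have "(p - q) * Im (M $ i $ j) = (p' - q') * Im (M $ i $ j)"
    using arg_cong[OF eq, of "\<lambda>X. Im (X $ i $ j)"] by (simp only: Im_combination_cconj)
  then show "Im (M $ i $ j) \<noteq> 0 \<Longrightarrow> p - q = p' - q'"
    by simp
qed

lemma sum_rotate3:
  "(\<Sum>i\<in>I. \<Sum>j\<in>J. \<Sum>l\<in>L. f i j l) = (\<Sum>l\<in>L. \<Sum>i\<in>I. \<Sum>j\<in>J. (f i j l :: 'a::comm_monoid_add))"
proof -
  have "(\<Sum>i\<in>I. \<Sum>j\<in>J. \<Sum>l\<in>L. f i j l) = (\<Sum>i\<in>I. \<Sum>l\<in>L. \<Sum>j\<in>J. f i j l)"
    by (rule sum.cong[OF refl], rule sum.swap)
  also have "\<dots> = (\<Sum>l\<in>L. \<Sum>i\<in>I. \<Sum>j\<in>J. f i j l)"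
    by (rule sum.swap)
  finally show ?thesis .
qed

definition quad_form :: "complex^'n^'n \<Rightarrow> complex^'n \<Rightarrow> complex" where
  "quad_form X x = (\<Sum>i\<in>UNIV. \<Sum>j\<in>UNIV. cnj (x $ i) * X $ i $ j * x $ j)"

lemma quad_form_combination:
  "quad_form (a *\<^sub>R X + b *\<^sub>R Y) x = of_real a * quad_form X x + of_real b * quad_form Y x"
proof -
  have "cnj (x $ i) * (a *\<^sub>R X + b *\<^sub>R Y) $ i $ j * x $ j
      = of_real a * (cnj (x $ i) * X $ i $ j * x $ j) + of_real b * (cnj (x $ i) * Y $ i $ j * x $ j)"
    for i j
    by (simp only: scaleR_combination_entry) (simp add: algebra_simps)
  then show ?thesis
    by (simp add: quad_form_def sum.distrib sum_distrib_left)
qed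

lemma quad_form_gram:
  "quad_form (A ** cadj A) x = of_real (\<Sum>l\<in>UNIV. (cmod (\<Sum>i\<in>UNIV. cnj (x $ i) * A $ i $ l))\<^sup>2)"
proof -
  have "quad_form (A ** cadj A) x
      = (\<Sum>i\<in>UNIV. \<Sum>j\<in>UNIV. \<Sum>l\<in>UNIV. (cnj (x $ i) * A $ i $ l) * cnj (cnj (x $ j) * A $ j $ l))"
    unfolding quad_form_def gram_entry sum_distrib_left sum_distrib_right
    by (simp add: mult_ac)
  also have "\<dots> = (\<Sum>l\<in>UNIV. \<Sum>i\<in>UNIV. \<Sum>j\<in>UNIV. (cnj (x $ i) * A $ i $ l) * cnj (cnj (x $ j) * A $ j $ l))"
    by (rule sum_rotate3)
  also have "\<dots> = (\<Sum>l\<in>UNIV. (\<Sum>i\<in>UNIV. cnj (x $ i) * A $ i $ l) * cnj (\<Sum>j\<in>UNIV. cnj (x $ j) * A $ j $ l))"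
    by (simp only: cnj_sum sum_product)
  also have "\<dots> = of_real (\<Sum>l\<in>UNIV. (cmod (\<Sum>i\<in>UNIV. cnj (x $ i) * A $ i $ l))\<^sup>2)"
    by (simp only: complex_norm_square[symmetric] of_real_sum)
  finally show ?thesis .
qed

lemma quad_form_cconj_gram:
  "quad_form (cconj (A ** cadj A)) x = of_real (\<Sum>l\<in>UNIV. (cmod (\<Sum>i\<in>UNIV. A $ i $ l * x $ i))\<^sup>2)"
proof -
  have "quad_form (cconj (A ** cadj A)) x
      = (\<Sum>i\<in>UNIV. \<Sum>j\<in>UNIV. \<Sum>l\<in>UNIV. cnj (A $ i $ l * x $ i) * (A $ j $ l * x $ j))"
    unfolding quad_form_def cconj_entry gram_entry cnj_sum sum_distrib_left sum_distrib_right
    by (simp add: mult_ac)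
  also have "\<dots> = (\<Sum>l\<in>UNIV. \<Sum>i\<in>UNIV. \<Sum>j\<in>UNIV. cnj (A $ i $ l * x $ i) * (A $ j $ l * x $ j))"
    by (rule sum_rotate3)
  also have "\<dots> = (\<Sum>l\<in>UNIV. cnj (\<Sum>i\<in>UNIV. A $ i $ l * x $ i) * (\<Sum>j\<in>UNIV. A $ j $ l * x $ j))"
    by (simp only: cnj_sum sum_product)
  also have "\<dots> = of_real (\<Sum>l\<in>UNIV. (cmod (\<Sum>i\<in>UNIV. A $ i $ l * x $ i))\<^sup>2)"
    by (simp only: complex_norm_square[symmetric] of_real_sum mult.commute[of "cnj _"])
  finally show ?thesis .
qed

lemma herm_psd_combination_gram:
  assumes "a \<ge> 0" "b \<ge> 0"
  shows "herm_psd (a *\<^sub>R (A ** cadj A) + b *\<^sub>R cconj (A ** cadj A))"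
  unfolding herm_psd_def
proof (intro conjI allI)
  show "cadj (a *\<^sub>R (A ** cadj A) + b *\<^sub>R cconj (A ** cadj A)) = a *\<^sub>R (A ** cadj A) + b *\<^sub>R cconj (A ** cadj A)"
    by (simp add: vec_eq_iff gram_entry mult.commute)
  fix x
  have "(\<Sum>i\<in>UNIV. \<Sum>j\<in>UNIV. cnj (x $ i) * (a *\<^sub>R (A ** cadj A) + b *\<^sub>R cconj (A ** cadj A)) $ i $ j * x $ j)
      = quad_form (a *\<^sub>R (A ** cadj A) + b *\<^sub>R cconj (A ** cadj A)) x"
    by (simp only: quad_form_def)
  also have "\<dots> = of_real (a * (\<Sum>l\<in>UNIV. (cmod (\<Sum>i\<in>UNIV. cnj (x $ i) * A $ i $ l))\<^sup>2)
      + b * (\<Sum>l\<in>UNIV. (cmod (\<Sum>i\<in>UNIV. A $ i $ l * x $ i))\<^sup>2))"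
    by (simp add: quad_form_combination quad_form_gram quad_form_cconj_gram)
  finally have eq: "(\<Sum>i\<in>UNIV. \<Sum>j\<in>UNIV. cnj (x $ i) * (a *\<^sub>R (A ** cadj A) + b *\<^sub>R cconj (A ** cadj A)) $ i $ j * x $ j)
      = of_real (a * (\<Sum>l\<in>UNIV. (cmod (\<Sum>i\<in>UNIV. cnj (x $ i) * A $ i $ l))\<^sup>2)
          + b * (\<Sum>l\<in>UNIV. (cmod (\<Sum>i\<in>UNIV. A $ i $ l * x $ i))\<^sup>2))" .
  show "(\<Sum>i\<in>UNIV. \<Sum>j\<in>UNIV. cnj (x $ i) * (a *\<^sub>R (A ** cadj A) + b *\<^sub>R cconj (A ** cadj A)) $ i $ j * x $ j) \<in> \<real>"
    unfolding eq by simp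
  show "0 \<le> Re (\<Sum>i\<in>UNIV. \<Sum>j\<in>UNIV. cnj (x $ i) * (a *\<^sub>R (A ** cadj A) + b *\<^sub>R cconj (A ** cadj A)) $ i $ j * x $ j)"
    unfolding eq using assms by (simp add: sum_nonneg)
qed

lemma Re_gram_diag_pos:
  assumes pd: "sym_pos_def (re_part A ** transpose (re_part A))"
  shows "Re ((A ** cadj A) $ i $ i) > 0"
proof -
  let ?P = "re_part A ** transpose (re_part A)"
  have "0 < axis i 1 \<bullet> (?P *v axis i 1)"
    using pd by (simp add: sym_pos_def_def)
  also have "axis i 1 \<bullet> (?P *v axis i 1) = ?P $ i $ i"
  proof -
    have "(?P *v axis i 1) $ i = ?P $ i $ i"
      unfolding matrix_vector_mult_def axis_def by (simp add: if_distrib[of "\<lambda>t. _ * t"] cong: if_cong)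
    then show ?thesis
      by (simp add: inner_axis')
  qed
  also have "\<dots> = (\<Sum>l\<in>UNIV. (Re (A $ i $ l))\<^sup>2)"
    by (simp add: matrix_matrix_mult_def re_part_def transpose_def power2_eq_square)
  also have "\<dots> \<le> (\<Sum>l\<in>UNIV. (Re (A $ i $ l))\<^sup>2 + (Im (A $ i $ l))\<^sup>2)"
    by (intro sum_mono) simp
  also have "\<dots> = Re ((A ** cadj A) $ i $ i)"
    by (simp add: gram_entry power2_eq_square)
  finally show ?thesis .
qed

lemma Im_gram:
  "Im ((A ** cadj A) $ i $ j) = (im_part A ** transpose (re_part A) - re_part A ** transpose (im_part A)) $ i $ j"
  by (simp add: gram_entry matrix_matrix_mult_def re_part_def im_part_def transpose_def
      sum_subtractf[symmetric])

lemma Xi_measure_eq: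
  "Xi_measure A L B = measure L B *\<^sub>R (A ** cadj A) + measure L (uminus ` B) *\<^sub>R cconj (A ** cadj A)"
  by (simp add: Xi_measure_def)

lemma Xi_measure_uminus: "Xi_measure A L (uminus ` B) = cconj (Xi_measure A L B)"
proof -
  have "uminus ` uminus ` B = B"
    by (simp add: image_image)
  then show ?thesis
    by (simp add: Xi_measure_eq vec_eq_iff add.commute)
qed

lemma herm_psd_Xi_measure: "herm_psd (Xi_measure A L B)"
  unfolding Xi_measure_eq by (rule herm_psd_combination_gram) simp_all

lemma mat_supp_Xi_measure:
  assumes pos: "\<And>W p. open W \<Longrightarrow> p \<in> W \<inter> sphere 0 1 \<Longrightarrow> measure L (W \<inter> sphere 0 1) > 0"
    and Re: "Re ((A ** cadj A) $ i $ i) > 0"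
  shows "mat_supp (Xi_measure A L) = sphere 0 1"
proof -
  have "Xi_measure A L (U \<inter> sphere 0 1) \<noteq> 0" if "open U" "\<theta> \<in> U" "\<theta> \<in> sphere 0 1" for U \<theta>
  proof
    let ?B = "U \<inter> sphere 0 1"
    assume "Xi_measure A L ?B = 0"
    then have "0 = Re (Xi_measure A L ?B $ i $ i)"
      by simp
    also have "\<dots> = (measure L ?B + measure L (uminus ` ?B)) * Re ((A ** cadj A) $ i $ i)"
      unfolding Xi_measure_eq by (rule Re_combination_cconj)
    also have "\<dots> > 0"
      using pos[OF that(1), of \<theta>] that(2,3) Re by (simp add: add_pos_nonneg)
    finally show False
      by simp
  qed
  then show ?thesis
    by (auto simp: mat_supp_def)
qed

lemma matrix_vector_mult_uminus: "(- M) *v x = - (M *v (x :: real^'n))"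
  by (simp add: vec_eq_iff matrix_vector_mult_def sum_negf)

lemma uminus_image_eq_sphere_vimage:
  assumes "B \<subseteq> sphere 0 1"
  shows "uminus ` B = {\<theta> \<in> sphere 0 1. (- mat 1) *v \<theta> \<in> (B :: (real^'n) set)}"
proof -
  have "(- mat 1) *v \<theta> = - \<theta>" for \<theta> :: "real^'n"
    by (simp add: matrix_vector_mult_uminus)
  then show ?thesis
    using assms by (force simp: image_iff)
qed

lemma uminus_image_sphere_vimage:
  fixes g :: "real^'n^'n"
  shows "uminus ` {\<theta> \<in> sphere 0 1. g *v \<theta> \<in> B} = {\<theta> \<in> sphere 0 1. g *v \<theta> \<in> uminus ` B}"
proof -
  have neg: "g *v (- \<theta>) = - (g *v \<theta>)" for \<theta> :: "real^'n"
    by (simp add: vec_eq_iff matrix_vector_mult_def sum_negf)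
  show ?thesis
  proof (intro set_eqI iffI)
    fix y assume "y \<in> uminus ` {\<theta> \<in> sphere 0 1. g *v \<theta> \<in> B}"
    then show "y \<in> {\<theta> \<in> sphere 0 1. g *v \<theta> \<in> uminus ` B}"
      by (auto simp: neg)
  next
    fix y assume y: "y \<in> {\<theta> \<in> sphere 0 1. g *v \<theta> \<in> uminus ` B}"
    then have "- y \<in> {\<theta> \<in> sphere 0 1. g *v \<theta> \<in> B}"
      by (auto simp: neg)
    then show "y \<in> uminus ` {\<theta> \<in> sphere 0 1. g *v \<theta> \<in> B}"
      by (rule rev_image_eqI) simp
  qed
qed

lemma uminus_image_in_sphere_borel:
  assumes "B \<in> sphere_borel"
  shows "uminus ` B \<in> sphere_borel"
  using sphere_vimage_in_sphere_borel[OF assms, of "- mat 1"] assms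
  by (simp add: uminus_image_eq_sphere_vimage mem_sphere_borel_iff)

lemma mem_S_dom_Xi_measure_if_invariant:
  assumes inv: "\<And>B. B \<in> sphere_borel \<Longrightarrow> measure L {\<theta> \<in> sphere 0 1. g *v \<theta> \<in> B} = measure L B"
  shows "g \<in> S_dom (Xi_measure A L)"
proof -
  have "Xi_measure A L {\<theta> \<in> sphere 0 1. g *v \<theta> \<in> B} = Xi_measure A L B" if B: "B \<in> sphere_borel" for B
    unfolding Xi_measure_eq uminus_image_sphere_vimage inv[OF B] inv[OF uminus_image_in_sphere_borel[OF B]] ..
  then show ?thesis
    unfolding S_dom_def by blast
qed

text \<open>The real part of a diagonal entry of Xi(B) determines Lambda(B) + Lambda(-B), a nonzero
  imaginary part of A A* determines Lambda(B) - Lambda(-B); if A A* is real, Lambda has to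
  be symmetric instead.\<close>

lemma invariant_if_mem_S_dom_Xi_measure:
  assumes C: "C \<in> S_dom (Xi_measure A L)" and B: "B \<in> sphere_borel"
    and Re: "Re ((A ** cadj A) $ i $ i) \<noteq> 0"
    and sym_or_Im: "(\<forall>X \<in> sphere_borel. measure L (uminus ` X) = measure L X)
      \<or> (\<exists>i j. Im ((A ** cadj A) $ i $ j) \<noteq> 0)"
  shows "measure L {\<theta> \<in> sphere 0 1. C *v \<theta> \<in> B} = measure L B"
proof -
  let ?X = "{\<theta> \<in> sphere 0 1. C *v \<theta> \<in> B}"
  have eq: "measure L ?X *\<^sub>R (A ** cadj A) + measure L (uminus ` ?X) *\<^sub>R cconj (A ** cadj A)
      = measure L B *\<^sub>R (A ** cadj A) + measure L (uminus ` B) *\<^sub>R cconj (A ** cadj A)"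
    using C B by (simp add: S_dom_def Xi_measure_eq)
  have sum: "measure L ?X + measure L (uminus ` ?X) = measure L B + measure L (uminus ` B)"
    using combination_cconj_cancel(1)[OF eq Re] .
  from sym_or_Im show ?thesis
  proof
    assume "\<forall>X \<in> sphere_borel. measure L (uminus ` X) = measure L X"
    then show ?thesis
      using sum B sphere_vimage_in_sphere_borel[OF B] by simp
  next
    assume "\<exists>i j. Im ((A ** cadj A) $ i $ j) \<noteq> 0"
    then obtain i j where "Im ((A ** cadj A) $ i $ j) \<noteq> 0"
      by blast
    then have "measure L ?X - measure L (uminus ` ?X) = measure L B - measure L (uminus ` B)"
      by (rule combination_cconj_cancel(2)[OF eq])
    then show ?thesis
      using sum by linarith
  qed
qed

lemma S_dom_Xi_orbit_measure:
  fixes G :: "(real^'m^'m) set" and A :: "complex^'n^'n"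
  assumes G: "maximal_compact_subgroup_O G"
    and V: "\<And>k. open (V k)" "\<And>U x. open U \<Longrightarrow> x \<in> U \<Longrightarrow> \<exists>k. x \<in> V k \<and> V k \<subseteq> U"
    and Re: "\<And>i. Re ((A ** cadj A) $ i $ i) > 0"
    and Im: "- mat 1 \<notin> G \<Longrightarrow> \<exists>i j. Im ((A ** cadj A) $ i $ j) \<noteq> 0"
  shows "S_dom (Xi_measure A (orbit_measure V G)) = G"
proof -
  let ?L = "orbit_measure V G"
  have OG: "orthogonal_subgroup G"
    using G by (rule maximal_compact_subgroup_O_imp_orthogonal_subgroup)
  interpret L: finite_measure ?L
    by (rule finite_measure_orbit_measure[where V = V, OF OG V(1)])
  have inv: "measure ?L {\<theta> \<in> sphere 0 1. g *v \<theta> \<in> B} = measure ?L B"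
    if "g \<in> G" "B \<in> sphere_borel" for g B
    using orbit_measure_invariant[where V = V, OF OG V(1) that] by (simp add: L.emeasure_eq_measure)
  have sym_or_Im: "(\<forall>X \<in> sphere_borel. measure ?L (uminus ` X) = measure ?L X)
      \<or> (\<exists>i j. Im ((A ** cadj A) $ i $ j) \<noteq> 0)"
  proof (cases "- mat 1 \<in> G")
    case True
    then show ?thesis
      using inv by (simp add: uminus_image_eq_sphere_vimage mem_sphere_borel_iff)
  qed (use Im in blast)
  show ?thesis
  proof
    show "G \<subseteq> S_dom (Xi_measure A ?L)"
      using inv by (blast intro: mem_S_dom_Xi_measure_if_invariant)
    show "S_dom (Xi_measure A ?L) \<subseteq> G"
    proof
      fix C assume C: "C \<in> S_dom (Xi_measure A ?L)"
      have preserves: "emeasure ?L {\<theta> \<in> sphere 0 1. C *v \<theta> \<in> B} = emeasure ?L B"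
        if "B \<in> sphere_borel" for B
        using invariant_if_mem_S_dom_Xi_measure[OF C that Re[of undefined, THEN less_imp_neq, THEN not_sym]
            sym_or_Im]
        by (simp add: L.emeasure_eq_measure)
      show "C \<in> G"
        using G V preserves by (rule mem_group_if_preserves_orbit_measure)
    qed
  qed
qed

lemma finite_components_sphere: "finite (components (sphere (0::real^'n) 1))"
proof (cases "CARD('n) \<ge> 2")
  case True
  then have "connected (sphere (0::real^'n) 1)" "sphere (0::real^'n) 1 \<noteq> {}"
    by (simp_all add: connected_sphere sphere_eq_empty)
  then show ?thesis
    by (simp add: components_eq_sing_iff[THEN iffD2])
next
  case False
  then have "CARD('n) = 1"
    using zero_less_card_finite[where 'a='n] by linarith
  then obtain i0 :: 'n where U: "UNIV = {i0}"
    by (metis card_1_singletonE)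
  have "sphere (0::real^'n) 1 \<subseteq> {vec 1, vec (-1)}"
  proof
    fix x :: "real^'n" assume "x \<in> sphere 0 1"
    moreover have "norm x = \<bar>x $ i0\<bar>"
      unfolding norm_vec_def L2_set_def U by simp
    moreover have "x = vec (x $ i0)"
      by (simp add: vec_eq_iff) (metis U UNIV_I singletonD)
    ultimately show "x \<in> {vec 1, vec (-1)}"
      by (auto simp: abs_if split: if_splits)
  qed
  then have "finite (sphere (0::real^'n) 1)"
    by (rule finite_subset) simp
  moreover have "components (sphere (0::real^'n) 1) \<subseteq> Pow (sphere 0 1)"
    using in_components_subset by blast
  ultimately show ?thesis
    by (meson finite_Pow_iff finite_subset)
qed

theorem lemmaA5:
  fixes G :: "(real^'m^'m) set" and A :: "complex^'n^'n"
  assumes G: "maximal_compact_subgroup_O G"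
    and pd: "sym_pos_def (re_part A ** transpose (re_part A))"
    and a: "- mat 1 \<notin> G \<Longrightarrow>
              im_part A ** transpose (re_part A) - re_part A ** transpose (im_part A) \<noteq> 0"
    and b: "- mat 1 \<in> G \<Longrightarrow> im_part A = 0"
    and m: "CARD('m) = 2 \<or> - mat 1 \<in> G"
  shows "\<exists>\<Lambda> :: (real^'m) measure.
           sets \<Lambda> = sphere_borel \<and> finite_measure \<Lambda> \<and>
           (\<forall>B \<in> sphere_borel. Xi_measure A \<Lambda> (uminus ` B) = cconj (Xi_measure A \<Lambda> B)) \<and>
           (\<forall>B \<in> sphere_borel. herm_psd (Xi_measure A \<Lambda> B)) \<and>
           finite (components (mat_supp (Xi_measure A \<Lambda>))) \<and>
           S_dom (Xi_measure A \<Lambda>) = G"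
proof -
  have OG: "orthogonal_subgroup G"
    using G by (rule maximal_compact_subgroup_O_imp_orthogonal_subgroup)
  obtain V :: "nat \<Rightarrow> (real^'m) set" where V: "\<And>k. open (V k)"
    and basis: "\<And>U x. open U \<Longrightarrow> x \<in> U \<Longrightarrow> \<exists>k. x \<in> V k \<and> V k \<subseteq> U"
    using ex_open_basis_sequence by blast
  let ?L = "orbit_measure V G"
  have Re: "Re ((A ** cadj A) $ i $ i) > 0" for i
    by (rule Re_gram_diag_pos[OF pd])
  have Im: "\<exists>i j. Im ((A ** cadj A) $ i $ j) \<noteq> 0" if "- mat 1 \<notin> G"
    using a[OF that] by (auto simp: vec_eq_iff Im_gram)
  have "mat_supp (Xi_measure A ?L) = sphere 0 1"
    using measure_orbit_measure_pos[where V = V, OF OG V] Re by (rule mat_supp_Xi_measure)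
  then show ?thesis
    using finite_measure_orbit_measure[where V = V, OF OG V] finite_components_sphere
      S_dom_Xi_orbit_measure[OF G V basis Re Im]
    by (intro exI[of _ ?L]) (simp add: Xi_measure_uminus herm_psd_Xi_measure)
qed

end
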